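(* Let $\varepsilon \in (0,1)$. Then there exists $\delta_0 = \delta_0(\varepsilon) > 0$ such that for every $0 < \delta \le \delta_0$, $$N_3(X,\delta) = \Omega_\delta(X^{1-\varepsilon}) \quad \text{and} \quad N_4(X,\delta) = \Omega_\delta(X)$$ as $X \to \infty$.
   Context: For $d \in \mathbb{N} = \{1,2,3,\dots\}$, $\delta \in (0,1/2)$ and $X > 0$, $N_d(X,\delta)$ denotes the largest integer $n$ such that there exist points $p_1, \dots, p_n$ in the closed Euclidean ball $B_d(0,X) \subset \mathbb{R}^d$ of radius $X$ centred at the origin satisfying $\|\,|p_i - p_j|\,\| \ge \delta$ for all $i \ne j$. Here $|\cdot|$ is the Euclidean norm and, for a real number $t$, $\|t\|$ is the distance from $t$ to the nearest integer. (This maximum is finite since such a point set is $\delta$-separated.) The parameter $\delta$ is always understood to lie in $(0,1/2)$. Asymptotic notation is with respect to $X \to \infty$: $g(X) = \Omega_\delta(f(X))$ means that there are constants $c > 0$ and $X_0$ depending on $\delta$ (and on the fixed $\varepsilon$ where it appears) such that $g(X) \ge c f(X)$ for all $X \ge X_0$. *)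

theory Defs
  imports "HOL-Analysis.Analysis" "HOL-Library.Landau_Symbols"
begin

definition dist_nearest_int :: "real \<Rightarrow> real" where
  "dist_nearest_int t = \<bar>t - of_int (round t)\<bar>"

text \<open>\<open>int_avoiding p n X \<delta>\<close>: the points \<open>p 1, \<dots>, p n\<close> form an admissible configuration in
  the definition of \<open>N\<^sub>d(X, \<delta>)\<close>.\<close>

definition int_avoiding :: "(nat \<Rightarrow> real ^ 'd) \<Rightarrow> nat \<Rightarrow> real \<Rightarrow> real \<Rightarrow> bool" where
  "int_avoiding p n X \<delta> \<longleftrightarrow>
     (\<forall>i\<in>{1..n}. p i \<in> cball 0 X) \<and>
     (\<forall>i\<in>{1..n}. \<forall>j\<in>{1..n}. i \<noteq> j \<longrightarrow> dist_nearest_int (norm (p i - p j)) \<ge> \<delta>)"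

text \<open>\<open>N\<^sub>d(X, \<delta>)\<close>, with the dimension given as an index type: \<open>N\<^sub>3(X, \<delta>)\<close> is
  \<open>max_int_avoiding TYPE(3) X \<delta>\<close>. For \<open>\<delta> > 0\<close> the maximum exists, as shown by
  \<open>max_int_avoiding_attained\<close> and \<open>max_int_avoiding_upper\<close> below.\<close>

definition max_int_avoiding :: "'d::finite itself \<Rightarrow> real \<Rightarrow> real \<Rightarrow> nat" where
  "max_int_avoiding _ X \<delta> = (GREATEST n. \<exists>p :: nat \<Rightarrow> real ^ 'd. int_avoiding p n X \<delta>)"

lemma dist_nearest_int_le_abs: "dist_nearest_int t \<le> \<bar>t\<bar>"
  using round_diff_minimal[of t 0] by (simp add: dist_nearest_int_def)

lemma int_avoiding_bounded:
  assumes "\<delta> > 0"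
  shows "\<exists>b. \<forall>n. (\<exists>p :: nat \<Rightarrow> real ^ 'd. int_avoiding p n X \<delta>) \<longrightarrow> n \<le> b"
proof -
  have "\<delta>/2 > 0"
    using assms by simp
  moreover have "seq_compact (cball (0 :: real ^ 'd) X)"
    by (simp add: compact_imp_seq_compact)
  ultimately have "\<exists>K. finite K \<and> K \<subseteq> cball (0 :: real ^ 'd) X \<and>
      cball (0 :: real ^ 'd) X \<subseteq> (\<Union>x\<in>K. ball x (\<delta>/2))"
    by (rule seq_compact_imp_totally_bounded[rule_format, rotated])
  then obtain K where K: "finite K" "cball (0 :: real ^ 'd) X \<subseteq> (\<Union>x\<in>K. ball x (\<delta>/2))"
    by (elim exE conjE)
  have "n \<le> card K" if av: "int_avoiding p n X \<delta>" for n and p :: "nat \<Rightarrow> real ^ 'd"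
  proof -
    have "\<exists>x\<in>K. p i \<in> ball x (\<delta>/2)" if "i \<in> {1..n}" for i
    proof -
      have "p i \<in> cball 0 X"
        using av that by (simp add: int_avoiding_def)
      then show ?thesis using K(2) by blast
    qed
    then obtain f where f: "\<And>i. i \<in> {1..n} \<Longrightarrow> f i \<in> K \<and> p i \<in> ball (f i) (\<delta>/2)"
      by metis
    have "inj_on f {1..n}"
    proof (rule inj_onI, rule ccontr)
      fix i j assume ij: "i \<in> {1..n}" "j \<in> {1..n}" "f i = f j" "i \<noteq> j"
      have "dist (p i) (p j) < \<delta>"
        using f[OF ij(1)] f[OF ij(2)] ij(3) by (simp add: dist_triangle_half_r[of "f i"])
      moreover have "\<delta> \<le> norm (p i - p j)"
    proof -
      have "\<delta> \<le> dist_nearest_int (norm (p i - p j))"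
        using av ij(1,2,4) unfolding int_avoiding_def by blast
      also have "\<dots> \<le> norm (p i - p j)"
        using dist_nearest_int_le_abs[of "norm (p i - p j)"] by simp
      finally show ?thesis .
    qed
      ultimately show False by (simp add: dist_norm)
    qed
    with f K(1) have "card {1..n} \<le> card K" by (intro card_inj_on_le) auto
    then show ?thesis by simp
  qed
  then show ?thesis by blast
qed

lemma max_int_avoiding_attained:
  assumes "\<delta> > 0"
  shows "\<exists>p :: nat \<Rightarrow> real ^ 'd. int_avoiding p (max_int_avoiding TYPE('d) X \<delta>) X \<delta>"
proof -
  obtain b where "\<forall>n. (\<exists>p :: nat \<Rightarrow> real ^ 'd. int_avoiding p n X \<delta>) \<longrightarrow> n \<le> b"
    using int_avoiding_bounded[OF assms] by blast
  moreover have "\<exists>p :: nat \<Rightarrow> real ^ 'd. int_avoiding p 0 X \<delta>"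
    by (simp add: int_avoiding_def)
  ultimately show ?thesis
    unfolding max_int_avoiding_def
    by (intro GreatestI_nat[where P = "\<lambda>n. \<exists>p :: nat \<Rightarrow> real ^ 'd. int_avoiding p n X \<delta>"]) auto
qed

lemma max_int_avoiding_upper:
  fixes p :: "nat \<Rightarrow> real ^ 'd"
  assumes "\<delta> > 0" "int_avoiding p n X \<delta>"
  shows "n \<le> max_int_avoiding TYPE('d) X \<delta>"
proof -
  obtain b where "\<forall>n. (\<exists>p :: nat \<Rightarrow> real ^ 'd. int_avoiding p n X \<delta>) \<longrightarrow> n \<le> b"
    using int_avoiding_bounded[OF assms(1)] by blast
  with assms(2) show ?thesis
    unfolding max_int_avoiding_def
    by (intro Greatest_le_nat[where P = "\<lambda>n. \<exists>p :: nat \<Rightarrow> real ^ 'd. int_avoiding p n X \<delta>"]) auto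
qed

end

theory Submission
  imports Defs
begin

text \<open>
  If two points have first coordinates at integer distance \<open>D\<close> and remaining coordinates at squared
  distance \<open>Q\<close>, then their distance is about \<open>D + Q / (2 * D)\<close>. So it suffices to place many integers
  \<open>s\<close> on a line together with transversal positions \<open>y s\<close> such that \<open>(norm (y s - y t))\<^sup>2\<close> is comparable
  to \<open>\<bar>s - t\<bar>\<close>: after a constant scaling of \<open>y\<close> all fractional parts lie in a fixed compact subset
  of \<open>(0, 1/2]\<close>.

  With three transversal dimensions this can be done for all integers: a self-similar lattice path
  in \<open>\<int>\<^sup>3\<close> of dimension \<open>2\<close>, obtained by repeatedly replacing each cell of a self-avoiding path by
  a \<open>5 \<times> 5 \<times> 5\<close> cube that is crossed in exactly \<open>25 = 5\<^sup>2\<close> cells. With two transversal dimensions there is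
  no room for this, but one may restrict to the integers of a Cantor set in base \<open>(2 * h)\<^sup>2\<close>, with digits
  below \<open>h\<^sup>2\<close>, and map it to a planar Cantor set in base \<open>2 * h\<close>. The exponent lost is
  \<open>ln 2 / ln (2 * h)\<close>.
\<close>

section \<open>Distances slightly above an integer\<close>

text \<open>With \<open>e = x - D\<close>, the excess of the squares is
  \<open>e * (2 * D + e)\<close>. Its upper bound forces \<open>e \<le> 1/2\<close>, so it is at
  most \<open>3 * D * e\<close> and the lower bound yields
  \<open>\<alpha> / 3 \<le> e\<close>.\<close>

lemma dist_nearest_int_near_int:
  fixes x \<alpha> :: real and D :: int
  assumes "1 \<le> D" "0 \<le> x" "\<alpha> * D \<le> x\<^sup>2 - (real_of_int D)\<^sup>2" "x\<^sup>2 - (real_of_int D)\<^sup>2 \<le> D" "0 \<le> \<alpha>"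
  shows "\<alpha> / 3 \<le> dist_nearest_int x" "x \<le> D + 1/2"
proof -
  define e where "e = x - D"
  have D: "1 \<le> real_of_int D" using assms(1) by simp
  have sq: "x\<^sup>2 - (real_of_int D)\<^sup>2 = e * (2 * D + e)"
    by (simp add: e_def algebra_simps power2_eq_square)
  have "(real_of_int D)\<^sup>2 \<le> x\<^sup>2"
    using assms(3,5) D mult_nonneg_nonneg[of \<alpha> "real_of_int D"] by linarith
  then have e0: "0 \<le> e"
    using power2_le_imp_le[OF _ assms(2)] by (simp add: e_def)
  have "e * (2 * D) \<le> e * (2 * D + e)"
    using e0 by (intro mult_left_mono) auto
  then have "(2 * e) * D \<le> 1 * real_of_int D"
    using sq assms(4) by (simp add: mult_ac)
  then have e2: "e \<le> 1/2"
    using D by (subst (asm) mult_le_cancel_right_pos) auto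
  then show "x \<le> D + 1/2" by (simp add: e_def)
  have "\<alpha> * D \<le> e * (2 * D + e)"
    using sq assms(3) by simp
  also have "\<dots> \<le> e * (3 * D)"
    using e0 e2 D by (intro mult_left_mono) auto
  finally have "\<alpha> * D \<le> (3 * e) * D" by (simp add: mult_ac)
  then have "\<alpha> \<le> 3 * e"
    using D by (subst (asm) mult_le_cancel_right_pos) auto
  moreover have "e \<le> dist_nearest_int x"
  proof -
    \<comment> \<open>Since \<open>e \<le> 1/2\<close>, the integers from \<open>D + 1\<close>
      upwards are no closer to \<open>x\<close> than \<open>D\<close> is.\<close>
    have "e \<le> \<bar>x - of_int n\<bar>" for n
    proof (cases "n \<le> D")
      case True
      then have "real_of_int n \<le> D" by simp
      then show ?thesis unfolding e_def by linarith
    next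
      case False
      then have "real_of_int D + 1 \<le> n" by linarith
      then show ?thesis using e2 unfolding e_def by linarith
    qed
    then show ?thesis by (simp add: dist_nearest_int_def)
  qed
  ultimately show "\<alpha> / 3 \<le> dist_nearest_int x" by simp
qed

text \<open>As the origin is one of the points, every \<open>norm (p i)\<close> with
  \<open>i \<noteq> 0\<close> is itself a distance in the configuration, so containment in the ball
  follows from the same estimate as the separation.\<close>

lemma max_int_avoiding_ge:
  fixes p :: "nat \<Rightarrow> real ^ 'd" and A :: "nat \<Rightarrow> int" and X \<alpha> :: real
  assumes \<alpha>: "0 < \<delta>" "\<delta> \<le> \<alpha> / 3"
    and p0: "p 0 = 0" "A 0 = 0" and X: "0 \<le> X"
    and A: "\<And>i. i < n \<Longrightarrow> \<bar>A i\<bar> + 1 \<le> X"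
    and sep: "\<And>i j. i < n \<Longrightarrow> j < n \<Longrightarrow> i \<noteq> j \<Longrightarrow> A i \<noteq> A j \<and>
      \<alpha> * \<bar>A i - A j\<bar> \<le> (norm (p i - p j))\<^sup>2 - (real_of_int (A i - A j))\<^sup>2 \<and>
      (norm (p i - p j))\<^sup>2 - (real_of_int (A i - A j))\<^sup>2 \<le> \<bar>A i - A j\<bar>"
  shows "n \<le> max_int_avoiding TYPE('d) X \<delta>"
proof -
  have *: "\<alpha> / 3 \<le> dist_nearest_int (norm (p i - p j)) \<and> norm (p i - p j) \<le> \<bar>A i - A j\<bar> + 1/2"
    if "i < n" "j < n" "i \<noteq> j" for i j
    using sep[OF that] \<alpha> dist_nearest_int_near_int[of "\<bar>A i - A j\<bar>" "norm (p i - p j)" \<alpha>]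
    by auto
  have "norm (p i) \<le> X" if "i < n" for i
  proof (cases "i = 0")
    case False
    then show ?thesis
      using *[of i 0] A[OF that] that p0 by auto
  qed (use p0 X in simp)
  then have "int_avoiding (\<lambda>i. p (i - 1)) n X \<delta>"
    using * \<alpha> unfolding int_avoiding_def by (auto intro!: order.trans[OF \<alpha>(2)])
  then show ?thesis
    by (rule max_int_avoiding_upper[OF \<alpha>(1)])
qed

text \<open>\<open>Q\<close> is the squared transversal distance before scaling. Dividing it by
  \<open>c\<close> keeps the excess at most \<open>\<bar>A i - A j\<bar>\<close>, at the price of
  the lower constant \<open>1 / (b * c)\<close>.\<close>

lemma max_int_avoiding_ge_of_snowflake:
  fixes p :: "nat \<Rightarrow> real ^ 'd" and A :: "nat \<Rightarrow> int" and X b c :: real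
  assumes bc: "0 < b" "0 < c" and \<delta>: "0 < \<delta>" "\<delta> \<le> 1 / (3 * b * c)"
    and p0: "p 0 = 0" "A 0 = 0" and X: "0 \<le> X"
    and A: "\<And>i. i < n \<Longrightarrow> \<bar>A i\<bar> + 1 \<le> X"
    and norm: "\<And>i j. (norm (p i - p j))\<^sup>2 = (real_of_int (A i - A j))\<^sup>2 + Q i j / c"
    and sep: "\<And>i j. i < n \<Longrightarrow> j < n \<Longrightarrow> i \<noteq> j \<Longrightarrow>
      A i \<noteq> A j \<and> \<bar>A i - A j\<bar> \<le> b * Q i j \<and> Q i j \<le> c * \<bar>A i - A j\<bar>"
  shows "n \<le> max_int_avoiding TYPE('d) X \<delta>"
proof (rule max_int_avoiding_ge[of \<delta> "1 / (b * c)" p A X, OF \<delta>(1) _ p0 X A])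
  show "\<delta> \<le> 1 / (b * c) / 3"
    using \<delta>(2) by (simp add: mult_ac)
next
  fix i j assume "i < n" "j < n" "i \<noteq> j"
  from sep[OF this] bc show "A i \<noteq> A j \<and>
      1 / (b * c) * \<bar>A i - A j\<bar> \<le> (norm (p i - p j))\<^sup>2 - (real_of_int (A i - A j))\<^sup>2 \<and>
      (norm (p i - p j))\<^sup>2 - (real_of_int (A i - A j))\<^sup>2 \<le> \<bar>A i - A j\<bar>"
    unfolding norm by (simp add: field_simps)
qed

section \<open>A self-avoiding lattice path of dimension two\<close>

type_synonym lattice = "int \<times> int \<times> int"

definition units :: "lattice list" where
  "units = [(1,0,0), (-1,0,0), (0,1,0), (0,-1,0), (0,0,1), (0,0,-1)]"

fun smul :: "int \<Rightarrow> lattice \<Rightarrow> lattice" where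
  "smul c (x, y, z) = (c * x, c * y, c * z)"

fun cheb :: "lattice \<Rightarrow> int" where
  "cheb (x, y, z) = max \<bar>x\<bar> (max \<bar>y\<bar> \<bar>z\<bar>)"

fun rotate_axes :: "lattice \<Rightarrow> lattice" where
  "rotate_axes (x, y, z) = (y, z, x)"

fun cross :: "lattice \<Rightarrow> lattice \<Rightarrow> lattice" where
  "cross (a, b, c) (x, y, z) = (b * z - c * y, c * x - a * z, a * y - b * x)"

text \<open>For orthogonal units \<open>u\<close> and \<open>w\<close> the cross product completes a
  right-handed orthonormal frame; so one straight and one turning model piece serve all
  directions.\<close>

fun in_frame :: "lattice \<Rightarrow> lattice \<Rightarrow> lattice \<Rightarrow> lattice" where
  "in_frame u w (a, b, c) = smul a u + smul b w + smul c (cross u w)"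

text \<open>Both lists were found by computer search. They cross the cube \<open>{-2..2}\<^sup>3\<close> between the centres of
  two faces, in the frame where the path enters in direction \<open>(1, 0, 0)\<close> and leaves in direction
  \<open>(1, 0, 0)\<close> or \<open>(0, 1, 0)\<close>; apart from the two ends they stay in \<open>{-1..1}\<^sup>3\<close>.\<close>

definition straight_cells :: "lattice list" where
  "straight_cells =
    [(-2,0,0), (-1,0,0), (0,0,0), (0,1,0), (1,1,0), (1,1,1), (0,1,1), (-1,1,1), (-1,0,1),
     (0,0,1), (1,0,1), (1,-1,1), (0,-1,1), (-1,-1,1), (-1,-1,0), (0,-1,0), (1,-1,0),
     (1,-1,-1), (0,-1,-1), (-1,-1,-1), (-1,0,-1), (0,0,-1), (1,0,-1), (1,0,0), (2,0,0)]"

definition turn_cells :: "lattice list" where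
  "turn_cells =
    [(-2,0,0), (-1,0,0), (0,0,0), (1,0,0), (1,1,0), (1,1,1), (0,1,1), (-1,1,1), (-1,0,1),
     (0,0,1), (1,0,1), (1,-1,1), (0,-1,1), (-1,-1,1), (-1,-1,0), (0,-1,0), (1,-1,0),
     (1,-1,-1), (0,-1,-1), (-1,-1,-1), (-1,0,-1), (0,0,-1), (0,1,-1), (0,1,0), (0,2,0)]"

text \<open>When the path goes straight on, any unit orthogonal to \<open>u\<close> completes the
  frame; \<open>rotate_axes u\<close> is one.\<close>

definition cells :: "lattice \<Rightarrow> lattice \<Rightarrow> lattice list" where
  "cells u v = (if u = v then map (in_frame u (rotate_axes u)) straight_cells
                else map (in_frame u v) turn_cells)"

text \<open>The ends are fixed so that successive crossings fit together; the bound 1 on all other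
  cells keeps crossings of non-consecutive cubes apart. Quantifying over lists makes the predicate
  executable.\<close>

definition crossing :: "lattice \<Rightarrow> lattice \<Rightarrow> lattice list \<Rightarrow> bool" where
  "crossing u v ps \<longleftrightarrow> length ps = 25 \<and> ps ! 0 = smul (-2) u \<and> ps ! 24 = smul 2 v \<and>
     (\<forall>r\<in>set [0..<24]. ps ! Suc r - ps ! r \<in> set units) \<and> distinct ps \<and>
     (\<forall>r\<in>set [1..<24]. cheb (ps ! r) \<le> 1)"

text \<open>A finite check by evaluation, over the 30 pairs of directions that do not
  reverse.\<close>

lemma crossing_cells_all:
  "\<forall>u\<in>set units. \<forall>v\<in>set units. v \<noteq> smul (-1) u \<longrightarrow> crossing u v (cells u v)"
  by code_simp


section \<open>The maximum norm on the lattice\<close>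

lemma cheb_zero: "cheb 0 = 0"
  by (simp add: zero_prod_def)

lemma cheb_add: "cheb (a + b) \<le> cheb a + cheb b"
  by (cases a; cases b)
    (auto intro!: order_trans[OF abs_triangle_ineq] add_mono simp: le_max_iff_disj)

lemma cheb_diff: "cheb (a - b) \<le> cheb a + cheb b"
  by (cases a; cases b)
    (auto intro!: order_trans[OF abs_triangle_ineq4] add_mono simp: le_max_iff_disj)

lemma cheb_minus_commute: "cheb (a - b) = cheb (b - a)"
proof -
  have "cheb (- c) = cheb c" for c by (cases c) simp
  from this[of "a - b"] show ?thesis by simp
qed

lemma cheb_smul: "cheb (smul c a) = \<bar>c\<bar> * cheb a"
  by (cases a) (auto simp: abs_mult max_mult_distrib_left)

lemma cheb_ge_1: "a \<noteq> 0 \<Longrightarrow> 1 \<le> cheb a"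
  by (cases a) (auto simp: zero_prod_def)

lemma cheb_unit: "u \<in> set units \<Longrightarrow> cheb u = 1"
  by (auto simp: units_def)

lemma smul_diff: "smul c (a - b) = smul c a - smul c b"
  by (cases a; cases b) (auto simp: algebra_simps)

lemma smul_uminus: "smul (- c) a = - smul c a"
  by (cases a) auto

lemma smul_one: "smul 1 a = a"
  by (cases a) auto

section \<open>One refinement of a self-avoiding path\<close>

definition self_avoiding :: "(int \<Rightarrow> lattice) \<Rightarrow> bool" where
  "self_avoiding G \<longleftrightarrow> (\<forall>k. G (k + 1) - G k \<in> set units) \<and> inj G"

text \<open>The cube with centre \<open>smul 5 (G k)\<close> is visited at the times
  \<open>25 * k\<close> to \<open>25 * k + 24\<close>. Paths are indexed by all integers, so every
  cube has both an entry and an exit direction.\<close>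

definition local_cell :: "(int \<Rightarrow> lattice) \<Rightarrow> int \<Rightarrow> lattice" where
  "local_cell G s =
     cells (G (s div 25) - G (s div 25 - 1)) (G (s div 25 + 1) - G (s div 25)) ! nat (s mod 25)"

definition refine :: "(int \<Rightarrow> lattice) \<Rightarrow> int \<Rightarrow> lattice" where
  "refine G s = smul 5 (G (s div 25)) + local_cell G s"

text \<open>Injectivity of \<open>G\<close> rules out a reversal, the one case left out of the
  finite check.\<close>

lemma crossing_cells:
  assumes "self_avoiding G"
  shows "crossing (G k - G (k - 1)) (G (k + 1) - G k)
           (cells (G k - G (k - 1)) (G (k + 1) - G k))"
proof -
  have u: "G k - G (k - 1) \<in> set units"
    using assms unfolding self_avoiding_def by (metis diff_add_cancel)
  have v: "G (k + 1) - G k \<in> set units"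
    using assms unfolding self_avoiding_def by blast
  have "G (k + 1) \<noteq> G (k - 1)"
    using assms unfolding self_avoiding_def inj_def by force
  then have "G (k + 1) - G k \<noteq> smul (- 1) (G k - G (k - 1))"
    by (simp add: smul_uminus smul_one)
  with u v show ?thesis
    using crossing_cells_all by blast
qed

lemma local_cell_cases:
  assumes G: "self_avoiding G"
  obtains (entry) "local_cell G s = smul (- 2) (G (s div 25) - G (s div 25 - 1))"
  | (exit) "local_cell G s = smul 2 (G (s div 25 + 1) - G (s div 25))"
  | (inner) "cheb (local_cell G s) \<le> 1"
proof -
  have r: "s mod 25 = 0 \<or> s mod 25 = 24 \<or> nat (s mod 25) \<in> set [1..<24]"
    by auto
  show ?thesis
    using r crossing_cells[OF G, of "s div 25"] that
    unfolding local_cell_def crossing_def by auto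
qed

lemma unit_step:
  assumes "self_avoiding G"
  shows "G (k + 1) - G k \<in> set units" "G k - G (k - 1) \<in> set units"
  using assms unfolding self_avoiding_def by (blast, metis diff_add_cancel)

lemma cheb_local_cell:
  assumes G: "self_avoiding G"
  shows "cheb (local_cell G s) \<le> 2"
  by (rule local_cell_cases[OF G, of s]) (use unit_step[OF G] in \<open>auto simp: cheb_smul cheb_unit\<close>)

text \<open>Local positions have norm at most 2, hence the error 4. As 4 is less than 5, distinct
  cubes remain disjoint.\<close>

lemma cheb_refine_diff_ge:
  assumes G: "self_avoiding G"
  shows "5 * cheb (G (s div 25) - G (t div 25)) - 4 \<le> cheb (refine G s - refine G t)"
proof -
  have "smul 5 (G (s div 25) - G (t div 25))
      = (refine G s - refine G t) - (local_cell G s - local_cell G t)"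
    by (simp add: refine_def smul_diff)
  then have "5 * cheb (G (s div 25) - G (t div 25))
      \<le> cheb (refine G s - refine G t) + cheb (local_cell G s - local_cell G t)"
    by (metis cheb_diff cheb_smul abs_numeral)
  then show ?thesis
    using cheb_diff[of "local_cell G s" "local_cell G t"]
      cheb_local_cell[OF G, of s] cheb_local_cell[OF G, of t] by linarith
qed

lemma cheb_refine_diff_le:
  assumes G: "self_avoiding G"
  shows "cheb (refine G s - refine G t) \<le> 5 * cheb (G (s div 25) - G (t div 25)) + 4"
proof -
  have "refine G s - refine G t
      = smul 5 (G (s div 25) - G (t div 25)) + (local_cell G s - local_cell G t)"
    by (simp add: refine_def smul_diff)
  then have "cheb (refine G s - refine G t)
      \<le> 5 * cheb (G (s div 25) - G (t div 25)) + cheb (local_cell G s - local_cell G t)"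
    by (metis cheb_add cheb_smul abs_numeral)
  then show ?thesis
    using cheb_diff[of "local_cell G s" "local_cell G t"]
      cheb_local_cell[OF G, of s] cheb_local_cell[OF G, of t] by linarith
qed

text \<open>Only the ends of a crossing lie on the boundary of its cube, so crossings of neighbouring cubes
  touch only if the cubes are consecutive. This turns mere injectivity of the coarse path into
  separation of the fine one.\<close>

lemma cheb_face_cell_ge:
  assumes "w \<in> set units" "d \<noteq> 0" "d \<noteq> - w" "cheb b \<le> 2"
  shows "2 \<le> cheb (smul 5 d + smul 2 w - b)"
proof (rule ccontr)
  assume less: "\<not> 2 \<le> cheb (smul 5 d + smul 2 w - b)"
  obtain d1 d2 d3 where d: "d = (d1, d2, d3)" by (metis surj_pair)
  obtain b1 b2 b3 where b: "b = (b1, b2, b3)" by (metis surj_pair)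
  obtain w1 w2 w3 where w: "w = (w1, w2, w3)" by (metis surj_pair)
  have coord: "x = 0 \<or> x = - y" if "\<bar>5 * x + 2 * y - z\<bar> < 2" "\<bar>z\<bar> \<le> 2" "\<bar>y\<bar> \<le> 1" for x y z :: int
  proof -
    have "y = -1 \<or> y = 0 \<or> y = 1" using that(3) by linarith
    then show ?thesis using that(1,2) by (elim disjE; simp; presburger)
  qed
  have "\<bar>w1\<bar> \<le> 1" "\<bar>w2\<bar> \<le> 1" "\<bar>w3\<bar> \<le> 1"
    using cheb_unit[OF assms(1)] by (simp_all add: w)
  then have "d1 = 0 \<or> d1 = - w1" "d2 = 0 \<or> d2 = - w2" "d3 = 0 \<or> d3 = - w3"
    using less assms(4) coord[of d1 w1 b1] coord[of d2 w2 b2] coord[of d3 w3 b3]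
    by (simp_all add: d b w not_le)
  \<comment> \<open>A unit has a single nonzero coordinate, so the coordinatewise alternatives leave
    only \<open>d = 0\<close> and \<open>d = - w\<close>.\<close>
  then show False
    using assms(1-3) by (auto simp: units_def d w zero_prod_def)
qed

text \<open>At an end of its crossing, \<open>s\<close> is close only to the cube of index
  \<open>S - 1\<close> or \<open>S + 1\<close>, neither of which is that of \<open>t\<close>.
  Otherwise the distance is at least \<open>5 - 1 - 2\<close>.\<close>

lemma cheb_refine_separated:
  assumes G: "self_avoiding G" and st: "\<bar>s div 25 - t div 25\<bar> \<ge> 2"
  shows "2 \<le> cheb (refine G s - refine G t)"
proof -
  define S T where "S = s div 25" and "T = t div 25"
  have "inj G"
    using G by (simp add: self_avoiding_def)
  then have ne: "G S \<noteq> G T" "G (S - 1) \<noteq> G T" "G (S + 1) \<noteq> G T"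
    using st by (auto simp: inj_eq S_def T_def)
  have eq: "refine G s - refine G t = smul 5 (G S - G T) + local_cell G s - local_cell G t"
    by (simp add: refine_def smul_diff S_def T_def)
  note b = cheb_local_cell[OF G, of t]
  show ?thesis
  proof (rule local_cell_cases[OF G, of s])
    assume "local_cell G s = smul (- 2) (G (s div 25) - G (s div 25 - 1))"
    then have a: "local_cell G s = smul 2 (G (S - 1) - G S)"
      by (simp add: S_def smul_uminus smul_diff)
    have "G (S - 1) - G S \<in> set units"
    proof -
      have "- u \<in> set units" if "u \<in> set units" for u
        using that by (auto simp: units_def)
      from this[OF unit_step(2)[OF G]] show ?thesis by simp
    qed
    then show ?thesis
      unfolding eq a by (rule cheb_face_cell_ge) (use ne b in auto)
  next
    assume "local_cell G s = smul 2 (G (s div 25 + 1) - G (s div 25))"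
    then have a: "local_cell G s = smul 2 (G (S + 1) - G S)"
      by (simp add: S_def)
    show ?thesis
      unfolding eq a by (rule cheb_face_cell_ge) (use unit_step(1)[OF G] ne b in auto)
  next
    assume a: "cheb (local_cell G s) \<le> 1"
    have "smul 5 (G S - G T) = (refine G s - refine G t) - (local_cell G s - local_cell G t)"
      by (simp add: refine_def smul_diff S_def T_def)
    then have "5 * cheb (G S - G T)
        \<le> cheb (refine G s - refine G t) + cheb (local_cell G s - local_cell G t)"
      by (metis cheb_diff cheb_smul abs_numeral)
    moreover have "1 \<le> cheb (G S - G T)"
      using ne by (intro cheb_ge_1) simp
    ultimately show ?thesis
      using cheb_diff[of "local_cell G s" "local_cell G t"] a b by linarith
  qed
qed

lemma div_mod_25E:
  obtains q r where "s div 25 = q" "s mod 25 = r" "s = 25 * q + r" "0 \<le> r" "r < (25::int)"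
  using that[OF refl refl] by simp

lemma self_avoiding_refine:
  assumes G: "self_avoiding G"
  shows "self_avoiding (refine G)"
  unfolding self_avoiding_def
proof (intro conjI allI)
  fix s :: int
  obtain q r where qr: "s div 25 = q" "s mod 25 = r" "s = 25 * q + r" "0 \<le> r" "r < 25"
    by (rule div_mod_25E)
  show "refine G (s + 1) - refine G s \<in> set units"
  proof (cases "s mod 25 = 24")
    case True
    then have eq: "s + 1 = 25 * (q + 1) + 0"
      using qr by simp
    have d: "(s + 1) div 25 = s div 25 + 1" "(s + 1) mod 25 = 0"
      using int_div_pos_eq[OF eq] int_mod_pos_eq[OF eq] by (simp_all add: qr(1))
    have "local_cell G s = smul 2 (G (s div 25 + 1) - G (s div 25))"
      using True crossing_cells[OF G, of "s div 25"] by (simp add: local_cell_def crossing_def)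
    moreover have "local_cell G (s + 1) = smul (- 2) (G (s div 25 + 1) - G (s div 25))"
      using crossing_cells[OF G, of "s div 25 + 1"] by (simp add: local_cell_def crossing_def d)
    \<comment> \<open>Exit and entry face each other across the common face: of the distance 5
      between the centres, \<open>5 - 2 - 2 = 1\<close> remains.\<close>
    moreover have "smul 5 p + smul (- 2) (p - q) - (smul 5 q + smul 2 (p - q)) = p - q" for p q
      by (cases p; cases q) auto
    ultimately have "refine G (s + 1) - refine G s = G (s div 25 + 1) - G (s div 25)"
      by (simp add: refine_def d)
    then show ?thesis
      using unit_step(1)[OF G] by simp
  next
    case False
    then have r: "r < 24"
      using qr(2,5) by simp
    have eq: "s + 1 = 25 * q + (r + 1)"
      using qr(3) by simp
    have d: "(s + 1) div 25 = s div 25" "nat ((s + 1) mod 25) = Suc (nat (s mod 25))"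
      using int_div_pos_eq[OF eq] int_mod_pos_eq[OF eq] r qr(4)
      by (simp_all add: qr(1,2) nat_add_distrib)
    have r: "nat (s mod 25) \<in> set [0..<24]"
      using r qr(4) by (simp add: qr(2))
    have "local_cell G (s + 1) - local_cell G s \<in> set units"
      unfolding local_cell_def d using r crossing_cells[OF G, of "s div 25"]
      unfolding crossing_def by blast
    then show ?thesis
      by (simp add: refine_def d)
  qed
next
  show "inj (refine G)"
  proof (rule injI)
    fix s t :: int
    assume st: "refine G s = refine G t"
    have parents: "s div 25 = t div 25"
    proof (rule ccontr)
      assume "s div 25 \<noteq> t div 25"
      then have "G (s div 25) - G (t div 25) \<noteq> 0"
        using G by (auto simp: self_avoiding_def inj_eq)
      then show False
        using cheb_refine_diff_ge[OF G, of s t] cheb_ge_1[of "G (s div 25) - G (t div 25)"] st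
        by (simp add: cheb_zero)
    qed
    have "nat (s mod 25) = nat (t mod 25)"
      using st parents crossing_cells[OF G, of "s div 25"]
      by (auto simp: refine_def local_cell_def crossing_def nth_eq_iff_index_eq nat_less_iff)
    then have "s mod 25 = t mod 25"
      by (simp add: eq_nat_nat_iff)
    with parents show "s = t"
      by (metis div_mult_mod_eq)
  qed
qed

section \<open>The iterated path and its distortion\<close>

primrec curve :: "nat \<Rightarrow> int \<Rightarrow> lattice" where
  "curve 0 = (\<lambda>s. (s, 0, 0))"
| "curve (Suc k) = refine (curve k)"

lemma self_avoiding_curve: "self_avoiding (curve k)"
proof (induction k)
  case 0
  have "curve 0 (k + 1) - curve 0 k = (1, 0, 0)" for k
    by (simp add: zero_prod_def)
  then show ?case
    unfolding self_avoiding_def by (simp add: units_def inj_def)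
next
  case (Suc k)
  then show ?case by (simp add: self_avoiding_refine)
qed

text \<open>Here \<open>5 * \<sigma>\<close> is the side of the largest cubes in which \<open>s\<close> and \<open>t\<close> are not in the same or in
  consecutive cubes. The additive constants absorb the errors of one refinement, so that all
  inequalities persist with \<open>5 * \<sigma>\<close> for \<open>\<sigma>\<close>. The restriction on \<open>\<bar>s - t\<bar>\<close> is needed because beyond
  the coarsest scale the path is a straight line.\<close>

lemma curve_quasi_snowflake:
  assumes "s \<noteq> t" "\<bar>s - t\<bar> \<le> 25 ^ k"
  shows "(\<exists>\<sigma>\<ge>1. \<sigma> + 1 \<le> cheb (curve k s - curve k t) \<and> cheb (curve k s - curve k t) \<le> 50 * \<sigma> - 1 \<and>
            \<sigma>\<^sup>2 + 1 \<le> \<bar>s - t\<bar> \<and> \<bar>s - t\<bar> \<le> 1300 * \<sigma>\<^sup>2 - 1) \<or>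
         \<bar>s - t\<bar> \<le> 49 \<and> 1 \<le> cheb (curve k s - curve k t) \<and> cheb (curve k s - curve k t) \<le> 9"
  using assms
proof (induction k arbitrary: s t)
  case 0
  then have "\<bar>s - t\<bar> = 1" by simp
  then show ?case by (intro disjI2) (simp add: zero_prod_def)
next
  case (Suc k)
  define S T where "S = s div 25" and "T = t div 25"
  define c C where "c = cheb (curve (Suc k) s - curve (Suc k) t)" and "C = cheb (curve k S - curve k T)"
  note G = self_avoiding_curve[of k]
  have c1: "1 \<le> c"
  proof -
    have "inj (curve (Suc k))"
      using self_avoiding_curve[of "Suc k"] unfolding self_avoiding_def by blast
    then have "curve (Suc k) s \<noteq> curve (Suc k) t"
      using Suc.prems(1) by (auto dest: injD)
    then show ?thesis unfolding c_def by (intro cheb_ge_1) (simp only: right_minus_eq not_False_eq_True)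
  qed
  have ge: "5 * C - 4 \<le> c" and le: "c \<le> 5 * C + 4"
    using cheb_refine_diff_ge[OF G, of s t] cheb_refine_diff_le[OF G, of s t]
    by (simp_all add: c_def C_def S_def T_def)
  obtain r where S: "s = 25 * S + r" "0 \<le> r" "r < 25"
    unfolding S_def by (rule div_mod_25E[of s]) blast
  obtain r' where T: "t = 25 * T + r'" "0 \<le> r'" "r' < 25"
    unfolding T_def by (rule div_mod_25E[of t]) blast
  have "s - t = 25 * (S - T) + (r - r')" "\<bar>r - r'\<bar> \<le> 24"
    using S T by auto
  moreover have "25 * \<bar>d\<bar> - 24 \<le> \<bar>25 * d + e\<bar>" "\<bar>25 * d + e\<bar> \<le> 25 * \<bar>d\<bar> + 24"
    if "\<bar>e\<bar> \<le> 24" for d e :: int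
    using that by linarith+
  ultimately have D: "25 * \<bar>S - T\<bar> - 24 \<le> \<bar>s - t\<bar>" "\<bar>s - t\<bar> \<le> 25 * \<bar>S - T\<bar> + 24"
    by presburger+
  show ?case
  proof (cases "\<bar>S - T\<bar> \<le> 1")
    case True
    have "C \<le> 1"
    proof (cases "S = T")
      case True
      then show ?thesis by (simp add: C_def cheb_zero)
    next
      case False
      with \<open>\<bar>S - T\<bar> \<le> 1\<close> consider "S = T + 1" | "T = S + 1" by linarith
      then show ?thesis
      proof cases
        case 1
        then show ?thesis
          using cheb_unit[OF unit_step(1)[OF G, of T]] by (simp add: C_def)
      next
        case 2
        have "cheb (curve k T - curve k S) \<le> 1"
          using cheb_unit[OF unit_step(1)[OF G, of S]] 2 by simp
        then show ?thesis by (simp add: C_def cheb_minus_commute)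
      qed
    qed
    \<comment> \<open>The constants of the second alternative are \<open>49 = 25 + 24\<close> and
      \<open>9 = 5 * 1 + 4\<close>.\<close>
    with le c1 D True show ?thesis unfolding c_def by (intro disjI2 conjI; linarith)
  next
    case False
    then have "\<bar>s div 25 - t div 25\<bar> \<ge> 2"
      by (simp add: S_def T_def)
    from cheb_refine_separated[OF G this] have c2: "2 \<le> c"
      by (simp add: c_def)
    have "S \<noteq> T" using False by auto
    moreover have "\<bar>S - T\<bar> \<le> 25 ^ k"
      using Suc.prems(2) D by simp
    ultimately consider
      \<sigma> where "\<sigma> \<ge> 1" "\<sigma> + 1 \<le> C" "C \<le> 50 * \<sigma> - 1" "\<sigma>\<^sup>2 + 1 \<le> \<bar>S - T\<bar>" "\<bar>S - T\<bar> \<le> 1300 * \<sigma>\<^sup>2 - 1"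
      | "\<bar>S - T\<bar> \<le> 49" "1 \<le> C" "C \<le> 9"
      using Suc.IH[of S T] unfolding C_def by blast
    then show ?thesis
    proof cases
      case 1
      have "(5 * \<sigma>)\<^sup>2 = 25 * \<sigma>\<^sup>2"
        by (simp add: power2_eq_square)
      \<comment> \<open>The constants reproduce exactly, for instance
        \<open>5 * (\<sigma> + 1) - 4 = 5 * \<sigma> + 1\<close> and \<open>25 * (\<sigma>\<^sup>2 +
        1) - 24 = (5 * \<sigma>)\<^sup>2 + 1\<close>.\<close>
      with 1 ge le D have "5 * \<sigma> \<ge> 1 \<and> 5 * \<sigma> + 1 \<le> c \<and> c \<le> 50 * (5 * \<sigma>) - 1 \<and>
          (5 * \<sigma>)\<^sup>2 + 1 \<le> \<bar>s - t\<bar> \<and> \<bar>s - t\<bar> \<le> 1300 * (5 * \<sigma>)\<^sup>2 - 1"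
        by (intro conjI; linarith)
      then show ?thesis unfolding c_def by blast
    next
      case 2
      \<comment> \<open>The first scale at which the cubes separate: \<open>\<sigma> = 1\<close>,
        with \<open>c \<le> 5 * 9 + 4 = 49\<close> and
        \<open>\<bar>s - t\<bar> \<le> 25 * 49 + 24 = 1249\<close>. This is the source of 50 and
        1300.\<close>
      with c2 le D False have "(1::int) \<ge> 1 \<and> 1 + 1 \<le> c \<and> c \<le> 50 * 1 - 1 \<and>
          1\<^sup>2 + 1 \<le> \<bar>s - t\<bar> \<and> \<bar>s - t\<bar> \<le> 1300 * 1\<^sup>2 - 1"
        by (intro conjI; (simp only: power_one)?; linarith)
      then show ?thesis unfolding c_def by blast
    qed
  qed
qed

fun norm_sq :: "lattice \<Rightarrow> int" where
  "norm_sq (x, y, z) = x\<^sup>2 + y\<^sup>2 + z\<^sup>2"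

lemma norm_sq_bounds: "(cheb a)\<^sup>2 \<le> norm_sq a" "norm_sq a \<le> 3 * (cheb a)\<^sup>2"
proof -
  obtain x y z where a: "a = (x, y, z)" by (metis surj_pair)
  have "(cheb a)\<^sup>2 = x\<^sup>2 \<or> (cheb a)\<^sup>2 = y\<^sup>2 \<or> (cheb a)\<^sup>2 = z\<^sup>2"
    by (auto simp: a max_def)
  then show "(cheb a)\<^sup>2 \<le> norm_sq a"
    using zero_le_power2[of x] zero_le_power2[of y] zero_le_power2[of z] unfolding a norm_sq.simps
    by linarith
  have "x\<^sup>2 \<le> (cheb a)\<^sup>2" "y\<^sup>2 \<le> (cheb a)\<^sup>2" "z\<^sup>2 \<le> (cheb a)\<^sup>2"
    by (auto simp: a abs_le_square_iff[symmetric])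
  then show "norm_sq a \<le> 3 * (cheb a)\<^sup>2"
    by (simp add: a)
qed

text \<open>Elimination of \<open>\<sigma>\<close>; \<open>7500 = 3 * 50\<^sup>2\<close>, where 3 is
  the loss between the maximum and the Euclidean norm.\<close>

lemma curve_norm_sq_bounds:
  assumes "s \<noteq> t" "\<bar>s - t\<bar> \<le> 25 ^ k"
  shows "\<bar>s - t\<bar> \<le> 1300 * norm_sq (curve k s - curve k t)"
    "norm_sq (curve k s - curve k t) \<le> 7500 * \<bar>s - t\<bar>"
proof -
  define a where "a = \<bar>s - t\<bar>"
  define c Q where "c = cheb (curve k s - curve k t)" and "Q = norm_sq (curve k s - curve k t)"
  have Q: "c\<^sup>2 \<le> Q" "Q \<le> 3 * c\<^sup>2"
    unfolding c_def Q_def by (rule norm_sq_bounds)+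
  have "a \<le> 1300 * Q \<and> Q \<le> 7500 * a"
    using curve_quasi_snowflake[OF assms] unfolding c_def[symmetric] a_def[symmetric]
  proof (elim disjE exE conjE)
    fix \<sigma> :: int
    assume \<sigma>: "1 \<le> \<sigma>" "\<sigma> + 1 \<le> c" "c \<le> 50 * \<sigma> - 1" "\<sigma>\<^sup>2 + 1 \<le> a" "a \<le> 1300 * \<sigma>\<^sup>2 - 1"
    have "\<sigma>\<^sup>2 \<le> c\<^sup>2" "c\<^sup>2 \<le> (50 * \<sigma>)\<^sup>2"
      using \<sigma> by (intro power_mono; linarith)+
    then have "\<sigma>\<^sup>2 \<le> c\<^sup>2" "c\<^sup>2 \<le> 2500 * \<sigma>\<^sup>2"
      by (simp_all add: power_mult_distrib)
    then show ?thesis using \<sigma> Q by (intro conjI; linarith)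
  next
    assume c: "a \<le> 49" "1 \<le> c" "c \<le> 9"
    have "1\<^sup>2 \<le> c\<^sup>2" "c\<^sup>2 \<le> 9\<^sup>2"
      using c by (intro power_mono; simp)+
    then have "1 \<le> c\<^sup>2" "c\<^sup>2 \<le> 81" by simp_all
    moreover have "1 \<le> a" using assms(1) by (simp add: a_def)
    ultimately show ?thesis using c Q by (intro conjI; linarith)
  qed
  then show "\<bar>s - t\<bar> \<le> 1300 * norm_sq (curve k s - curve k t)"
    "norm_sq (curve k s - curve k t) \<le> 7500 * \<bar>s - t\<bar>"
    by (simp_all add: Q_def a_def)
qed

section \<open>Cantor sets in the line and in the plane\<close>

text \<open>The lowest \<open>k\<close> digits of \<open>n\<close> in base \<open>q\<close> are transformed by \<open>f\<close> and read in base \<open>B\<close>.\<close>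

primrec redigit :: "nat \<Rightarrow> nat \<Rightarrow> (nat \<Rightarrow> nat) \<Rightarrow> nat \<Rightarrow> nat \<Rightarrow> nat" where
  "redigit B q f 0 n = 0"
| "redigit B q f (Suc k) n = B * redigit B q f k (n div q) + f (n mod q)"

lemma redigit_0: "f 0 = 0 \<Longrightarrow> redigit B q f k 0 = 0"
  by (induction k) auto

lemma redigit_less:
  assumes "n < q ^ k" "q \<le> B"
  shows "redigit B q (\<lambda>d. d) k n < B ^ k"
  using assms
proof (induction k arbitrary: n)
  case (Suc k)
  then have "0 < q" by (cases "q = 0") auto
  have "n div q < q ^ k"
    using Suc.prems(1) by (simp add: less_mult_imp_div_less mult.commute)
  then have "redigit B q (\<lambda>d. d) k (n div q) + 1 \<le> B ^ k"
    using Suc by (simp add: Suc_le_eq)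
  then have "B * (redigit B q (\<lambda>d. d) k (n div q) + 1) \<le> B * B ^ k"
    by (rule mult_le_mono2)
  moreover have "n mod q < B"
    using \<open>0 < q\<close> Suc.prems(2) by (simp add: order.strict_trans2[OF mod_less_divisor])
  ultimately show ?case by simp
qed simp

text \<open>The effect of appending one digit in base \<open>m\<close>, with \<open>a\<close> the
  difference of the higher parts and \<open>e\<close> that of the last digits. The additive 1
  absorbs \<open>e\<close> because the digits occupy at most the lower half of the base.\<close>

lemma shifted_diff_bounds:
  fixes a e m :: int
  assumes "0 < m" "2 * \<bar>e\<bar> \<le> m - 1"
  shows "s + 1 \<le> 2 * \<bar>a\<bar> \<Longrightarrow> m * s + 1 \<le> 2 * \<bar>m * a + e\<bar>"
    and "\<bar>a\<bar> \<le> r - 1 \<Longrightarrow> \<bar>m * a + e\<bar> \<le> m * r - 1"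
proof -
  have triangle: "2 * \<bar>x\<bar> - 2 * \<bar>e\<bar> \<le> 2 * \<bar>x + e\<bar>" "\<bar>x + e\<bar> \<le> \<bar>x\<bar> + \<bar>e\<bar>" for x
    using abs_triangle_ineq4[of "x + e" e] abs_triangle_ineq[of x e] by simp_all
  have ma: "\<bar>m * a\<bar> = m * \<bar>a\<bar>"
    using assms(1) by (simp add: abs_mult)
  {
    assume "s + 1 \<le> 2 * \<bar>a\<bar>"
    then have "m * (s + 1) \<le> m * (2 * \<bar>a\<bar>)"
      using assms(1) by (intro mult_left_mono) auto
    then have "m * s + m \<le> 2 * \<bar>m * a\<bar>"
      by (simp add: ma distrib_left)
    then show "m * s + 1 \<le> 2 * \<bar>m * a + e\<bar>"
      using assms(2) triangle(1)[of "m * a"] by simp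
  next
    assume "\<bar>a\<bar> \<le> r - 1"
    then have "m * \<bar>a\<bar> \<le> m * (r - 1)"
      using assms(1) by (intro mult_left_mono) auto
    then have "\<bar>m * a\<bar> \<le> m * r - m"
      by (simp add: ma right_diff_distrib)
    then show "\<bar>m * a + e\<bar> \<le> m * r - 1"
      using assms(2) triangle(2)[of "m * a"] by simp
  }
qed

text \<open>Here \<open>\<sigma>\<close> is \<open>m\<close> to the position of the highest digit in which \<open>n\<close> and \<open>n'\<close> differ.\<close>

lemma redigit_quasi_snowflake:
  fixes h m k n n' :: nat
  defines "m \<equiv> 2 * h"
  defines "A \<equiv> \<lambda>k n. int (redigit (m\<^sup>2) (h\<^sup>2) (\<lambda>d. d) k n)"
    and "U \<equiv> \<lambda>k n. int (redigit m (h\<^sup>2) (\<lambda>d. d mod h) k n)"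
    and "V \<equiv> \<lambda>k n. int (redigit m (h\<^sup>2) (\<lambda>d. d div h) k n)"
  assumes "0 < h" "n < (h\<^sup>2) ^ k" "n' < (h\<^sup>2) ^ k" "n \<noteq> n'"
  shows "\<exists>\<sigma>\<ge>1. \<sigma>\<^sup>2 + 1 \<le> 2 * \<bar>A k n - A k n'\<bar> \<and> \<bar>A k n - A k n'\<bar> \<le> (\<sigma> * m)\<^sup>2 - 1 \<and>
      (\<sigma> + 1 \<le> 2 * \<bar>U k n - U k n'\<bar> \<or> \<sigma> + 1 \<le> 2 * \<bar>V k n - V k n'\<bar>) \<and>
      \<bar>U k n - U k n'\<bar> \<le> \<sigma> * m - 1 \<and> \<bar>V k n - V k n'\<bar> \<le> \<sigma> * m - 1"
  using assms(6-8)
proof (induction k arbitrary: n n')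
  case (Suc k)
  define q where "q = h\<^sup>2"
  define N N' r r' where "N = n div q" and "N' = n' div q" and "r = n mod q" and "r' = n' mod q"
  have q: "0 < q" "m\<^sup>2 = 4 * q"
    using \<open>0 < h\<close> by (simp_all add: q_def m_def power_mult_distrib)
  have r: "r < q" "r' < q"
    using q by (simp_all add: r_def r'_def)
  have lt: "r div h < h" "r' div h < h" "r mod h < h" "r' mod h < h"
    using r \<open>0 < h\<close> by (simp_all add: q_def power2_eq_square less_mult_imp_div_less)
  define eA eU eV where "eA = int r - int r'"
    and "eU = int (r mod h) - int (r' mod h)" and "eV = int (r div h) - int (r' div h)"
  have e: "2 * \<bar>eA\<bar> \<le> int (m\<^sup>2) - 1" "2 * \<bar>eU\<bar> \<le> int m - 1" "2 * \<bar>eV\<bar> \<le> int m - 1"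
  proof -
    have *: "\<bar>int x - int y\<bar> \<le> int b - 1" if "x < b" "y < b" for x y b
      using that by linarith
    show "2 * \<bar>eA\<bar> \<le> int (m\<^sup>2) - 1"
      using *[OF r] unfolding eA_def q(2) by simp
    show "2 * \<bar>eU\<bar> \<le> int m - 1" "2 * \<bar>eV\<bar> \<le> int m - 1"
      using *[OF lt(3,4)] *[OF lt(1,2)] unfolding eU_def eV_def m_def by simp_all
  qed
  have rec: "A (Suc k) n - A (Suc k) n' = int (m\<^sup>2) * (A k N - A k N') + eA"
    "U (Suc k) n - U (Suc k) n' = int m * (U k N - U k N') + eU"
    "V (Suc k) n - V (Suc k) n' = int m * (V k N - V k N') + eV"
    by (simp_all add: A_def U_def V_def N_def N'_def r_def r'_def q_def eA_def eU_def eV_def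
        algebra_simps)
  show ?case
  proof (cases "N = N'")
    case True
    then have "r \<noteq> r'"
      using Suc.prems(3) unfolding N_def N'_def r_def r'_def by (metis div_mult_mod_eq)
    \<comment> \<open>A digit \<open>d\<close> is determined by \<open>d mod h\<close> and
      \<open>d div h\<close>, so at least one planar coordinate differs.\<close>
    then have "eA \<noteq> 0" "eU \<noteq> 0 \<or> eV \<noteq> 0"
      unfolding eA_def eU_def eV_def by (simp, metis div_mult_mod_eq eq_iff_diff_eq_0 of_nat_eq_iff)
    with e True have "(1::int)\<^sup>2 + 1 \<le> 2 * \<bar>eA\<bar>" "\<bar>eA\<bar> \<le> (1 * int m)\<^sup>2 - 1"
      "1 + 1 \<le> 2 * \<bar>eU\<bar> \<or> 1 + 1 \<le> 2 * \<bar>eV\<bar>" "\<bar>eU\<bar> \<le> 1 * int m - 1" "\<bar>eV\<bar> \<le> 1 * int m - 1"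
      by auto
    then show ?thesis
      unfolding rec using True by (intro exI[of _ 1]) simp
  next
    case False
    have "N < (h\<^sup>2) ^ k" "N' < (h\<^sup>2) ^ k"
      using Suc.prems(1,2) by (simp_all add: N_def N'_def q_def less_mult_imp_div_less mult.commute)
    from Suc.IH[OF this False] obtain \<sigma> :: int where \<sigma>: "\<sigma> \<ge> 1"
      "\<sigma>\<^sup>2 + 1 \<le> 2 * \<bar>A k N - A k N'\<bar>" "\<bar>A k N - A k N'\<bar> \<le> (\<sigma> * m)\<^sup>2 - 1"
      "\<sigma> + 1 \<le> 2 * \<bar>U k N - U k N'\<bar> \<or> \<sigma> + 1 \<le> 2 * \<bar>V k N - V k N'\<bar>"
      "\<bar>U k N - U k N'\<bar> \<le> \<sigma> * m - 1" "\<bar>V k N - V k N'\<bar> \<le> \<sigma> * m - 1"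
      by blast
    have m: "0 < int m" "0 < int (m\<^sup>2)"
      using \<open>0 < h\<close> by (simp_all add: m_def)
    \<comment> \<open>The new witness is \<open>int m * \<sigma>\<close>: one more digit scales the
      plane by \<open>m\<close> and the line by \<open>m\<^sup>2\<close>.\<close>
    have "1 \<le> int m * \<sigma>"
      using \<sigma>(1) m(1) by (simp add: int_one_le_iff_zero_less zero_less_mult_iff)
    moreover have "(int m * \<sigma>)\<^sup>2 + 1 \<le> 2 * \<bar>A (Suc k) n - A (Suc k) n'\<bar>"
      using shifted_diff_bounds(1)[OF m(2) e(1) \<sigma>(2)] by (simp add: rec power_mult_distrib)
    moreover have "\<bar>A (Suc k) n - A (Suc k) n'\<bar> \<le> (int m * \<sigma> * m)\<^sup>2 - 1"
      using shifted_diff_bounds(2)[OF m(2) e(1) \<sigma>(3)]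
      by (simp add: rec power_mult_distrib mult_ac)
    moreover have "int m * \<sigma> + 1 \<le> 2 * \<bar>U (Suc k) n - U (Suc k) n'\<bar> \<or>
        int m * \<sigma> + 1 \<le> 2 * \<bar>V (Suc k) n - V (Suc k) n'\<bar>"
      using \<sigma>(4) shifted_diff_bounds(1)[OF m(1) e(2)] shifted_diff_bounds(1)[OF m(1) e(3)]
      unfolding rec by blast
    moreover have "\<bar>U (Suc k) n - U (Suc k) n'\<bar> \<le> int m * \<sigma> * m - 1"
      "\<bar>V (Suc k) n - V (Suc k) n'\<bar> \<le> int m * \<sigma> * m - 1"
      using shifted_diff_bounds(2)[OF m(1) e(2) \<sigma>(5)] shifted_diff_bounds(2)[OF m(1) e(3) \<sigma>(6)]
      by (simp_all add: rec mult.assoc)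
    ultimately show ?thesis by blast
  qed
qed simp

text \<open>Both quantities are comparable to \<open>\<sigma>\<^sup>2\<close>; for the lower bound
  on \<open>Q\<close> a single planar coordinate suffices.\<close>

lemma redigit_norm_sq_bounds:
  fixes h k n n' :: nat
  defines "m \<equiv> 2 * h"
  defines "D \<equiv> \<bar>int (redigit (m\<^sup>2) (h\<^sup>2) (\<lambda>d. d) k n) - int (redigit (m\<^sup>2) (h\<^sup>2) (\<lambda>d. d) k n')\<bar>"
    and "Q \<equiv> (int (redigit m (h\<^sup>2) (\<lambda>d. d mod h) k n) - int (redigit m (h\<^sup>2) (\<lambda>d. d mod h) k n'))\<^sup>2 +
      (int (redigit m (h\<^sup>2) (\<lambda>d. d div h) k n) - int (redigit m (h\<^sup>2) (\<lambda>d. d div h) k n'))\<^sup>2"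
  assumes "0 < h" "n < (h\<^sup>2) ^ k" "n' < (h\<^sup>2) ^ k" "n \<noteq> n'"
  shows "0 < D" "D \<le> 4 * (int m)\<^sup>2 * Q" "Q \<le> 4 * (int m)\<^sup>2 * D"
proof -
  define u v where "u = int (redigit m (h\<^sup>2) (\<lambda>d. d mod h) k n) - int (redigit m (h\<^sup>2) (\<lambda>d. d mod h) k n')"
    and "v = int (redigit m (h\<^sup>2) (\<lambda>d. d div h) k n) - int (redigit m (h\<^sup>2) (\<lambda>d. d div h) k n')"
  have Q: "Q = u\<^sup>2 + v\<^sup>2" by (simp add: Q_def u_def v_def)
  obtain \<sigma> :: int where \<sigma>: "\<sigma> \<ge> 1" "\<sigma>\<^sup>2 + 1 \<le> 2 * D" "D \<le> (\<sigma> * m)\<^sup>2 - 1"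
    "\<sigma> + 1 \<le> 2 * \<bar>u\<bar> \<or> \<sigma> + 1 \<le> 2 * \<bar>v\<bar>" "\<bar>u\<bar> \<le> \<sigma> * m - 1" "\<bar>v\<bar> \<le> \<sigma> * m - 1"
    using redigit_quasi_snowflake[OF assms(4-7)] unfolding D_def u_def v_def m_def by blast
  have sq: "\<sigma>\<^sup>2 \<le> 4 * w\<^sup>2" if "\<sigma> + 1 \<le> 2 * \<bar>w\<bar>" for w
  proof -
    have "\<sigma>\<^sup>2 \<le> (2 * \<bar>w\<bar>)\<^sup>2" using that \<sigma>(1) by (intro power_mono) auto
    then show ?thesis by (simp add: power_mult_distrib)
  qed
  have "\<sigma>\<^sup>2 \<le> 4 * Q"
    using \<sigma>(4)
  proof
    assume "\<sigma> + 1 \<le> 2 * \<bar>u\<bar>"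
    from sq[OF this] show ?thesis by (simp add: Q add_increasing2)
  next
    assume "\<sigma> + 1 \<le> 2 * \<bar>v\<bar>"
    from sq[OF this] show ?thesis by (simp add: Q add_increasing)
  qed
  then have "(int m)\<^sup>2 * \<sigma>\<^sup>2 \<le> (int m)\<^sup>2 * (4 * Q)"
    by (intro mult_left_mono) auto
  then show "D \<le> 4 * (int m)\<^sup>2 * Q"
    using \<sigma>(3) by (simp add: power_mult_distrib mult_ac)
  have "\<bar>u\<bar>\<^sup>2 \<le> (\<sigma> * m)\<^sup>2" "\<bar>v\<bar>\<^sup>2 \<le> (\<sigma> * m)\<^sup>2"
    using \<sigma>(5,6) by (intro power_mono; simp)+
  then have "Q \<le> 2 * (int m)\<^sup>2 * \<sigma>\<^sup>2"
    unfolding Q by (simp add: power_mult_distrib mult_ac)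
  also have "\<dots> \<le> 2 * (int m)\<^sup>2 * (2 * D)"
    using \<sigma>(2) by (intro mult_left_mono) auto
  finally show "Q \<le> 4 * (int m)\<^sup>2 * D" by simp
  show "0 < D" using \<sigma>(2) zero_le_power2[of \<sigma>] by linarith
qed

section \<open>The lower bounds in dimensions three and four\<close>

text \<open>\<open>A\<close> is placed on the first axis, \<open>U\<close> and \<open>V\<close>
  divided by \<open>4 * h\<close> on the other two. Both comparison constants are
  \<open>4 * (2 * h)\<^sup>2 = 16 * h\<^sup>2\<close>.\<close>

lemma max_int_avoiding_3_ge:
  fixes X :: real and h :: nat
  assumes h: "0 < h" and \<delta>: "0 < \<delta>" "\<delta> \<le> 1 / (3 * (16 * (real h)\<^sup>2) * (16 * (real h)\<^sup>2))"
    and X: "real ((4 * h\<^sup>2) ^ k) \<le> X"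
  shows "(h\<^sup>2) ^ k \<le> max_int_avoiding TYPE(3) X \<delta>"
proof -
  define A U V where "A i = int (redigit ((2 * h)\<^sup>2) (h\<^sup>2) (\<lambda>d. d) k i)"
    and "U i = int (redigit (2 * h) (h\<^sup>2) (\<lambda>d. d mod h) k i)"
    and "V i = int (redigit (2 * h) (h\<^sup>2) (\<lambda>d. d div h) k i)" for i
  define c where "c = sqrt (16 * (real h)\<^sup>2)"
  have c: "c\<^sup>2 = 16 * (real h)\<^sup>2" "c > 0" using h by (simp_all add: c_def)
  define p :: "nat \<Rightarrow> real ^ 3" where
    "p i = (\<chi> j. if j = 1 then A i else if j = 2 then U i / c else V i / c)" for i
  have norm: "(norm (p i - p j))\<^sup>2 = (real_of_int (A i - A j))\<^sup>2
      + ((U i - U j)\<^sup>2 + (V i - V j)\<^sup>2) / (16 * (real h)\<^sup>2)" for i j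
    unfolding power2_norm_eq_inner c(1)[symmetric] using c(2)
    by (simp add: inner_vec_def sum_3 p_def field_simps power2_eq_square)
  show ?thesis
  proof (rule max_int_avoiding_ge_of_snowflake[OF _ _ \<delta> _ _ _ _ norm])
    show "p 0 = 0" "A 0 = 0"
      by (simp_all add: p_def A_def U_def V_def redigit_0 vec_eq_iff)
    show "0 \<le> X" using X order_trans[of 0 "real ((4 * h\<^sup>2) ^ k)"] by simp
  next
    fix i assume "i < (h\<^sup>2) ^ k"
    then have "redigit ((2 * h)\<^sup>2) (h\<^sup>2) (\<lambda>d. d) k i < ((2 * h)\<^sup>2) ^ k"
      by (rule redigit_less) (simp add: power_mult_distrib)
    then have "real (redigit ((2 * h)\<^sup>2) (h\<^sup>2) (\<lambda>d. d) k i + 1) \<le> real ((4 * h\<^sup>2) ^ k)"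
      by (subst of_nat_le_iff) (simp add: power_mult_distrib Suc_le_eq)
    with X show "real_of_int (\<bar>A i\<bar> + 1) \<le> X"
      by (simp add: A_def)
  next
    fix i j assume "i < (h\<^sup>2) ^ k" "j < (h\<^sup>2) ^ k" "i \<noteq> j"
    note * = redigit_norm_sq_bounds[OF h this, folded A_def U_def V_def]
    have "4 * (int (2 * h))\<^sup>2 = 16 * (int h)\<^sup>2" by (simp add: power_mult_distrib)
    with * have "real_of_int \<bar>A i - A j\<bar> \<le> real_of_int (16 * (int h)\<^sup>2 * ((U i - U j)\<^sup>2 + (V i - V j)\<^sup>2))"
      "real_of_int ((U i - U j)\<^sup>2 + (V i - V j)\<^sup>2) \<le> real_of_int (16 * (int h)\<^sup>2 * \<bar>A i - A j\<bar>)"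
      by (simp_all only: of_int_le_iff)
    with *(1) show "A i \<noteq> A j \<and>
       real_of_int \<bar>A i - A j\<bar> \<le> (16 * (real h)\<^sup>2) * real_of_int ((U i - U j)\<^sup>2 + (V i - V j)\<^sup>2) \<and>
       real_of_int ((U i - U j)\<^sup>2 + (V i - V j)\<^sup>2) \<le> (16 * (real h)\<^sup>2) * real_of_int \<bar>A i - A j\<bar>"
      by auto
  qed (use h in auto)
qed

text \<open>With \<open>h = 2 ^ l\<close> there are \<open>4 ^ (l * k)\<close> points within radius
  \<open>4 ^ ((l + 1) * k)\<close>, which gives the exponent
  \<open>l / (l + 1) = 1 - 1 / (l + 1)\<close>. The factor \<open>4 ^ l\<close> pays for rounding
  \<open>X\<close> to a power of \<open>4 ^ (l + 1)\<close>.\<close>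

lemma max_int_avoiding_3_growth:
  fixes \<epsilon> X \<delta> :: real and l :: nat
  assumes l: "0 < l" "1 / (l + 1) \<le> \<epsilon>"
    and \<delta>: "0 < \<delta>" "\<delta> \<le> 1 / (3 * (16 * 4 ^ l) * (16 * 4 ^ l))" and X: "1 \<le> X"
  shows "X powr (1 - \<epsilon>) \<le> 4 ^ l * max_int_avoiding TYPE(3) X \<delta>"
proof -
  have h: "((2::nat) ^ l)\<^sup>2 = 4 ^ l"
    by (simp add: power2_eq_square flip: power_mult_distrib)
  have "1 \<le> nat \<lfloor>X\<rfloor>" using X by linarith
  then obtain k where k: "((4::nat) ^ (l + 1)) ^ k \<le> nat \<lfloor>X\<rfloor>" "nat \<lfloor>X\<rfloor> < (4 ^ (l + 1)) ^ (k + 1)"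
    using ex_power_ivl1[of "4 ^ (l + 1)" "nat \<lfloor>X\<rfloor>"] by (auto simp: one_le_power)
  have le: "real ((4 ^ (l + 1)) ^ k) \<le> X"
    using k(1) X by linarith
  have "nat \<lfloor>X\<rfloor> + 1 \<le> (4 ^ (l + 1)) ^ (k + 1)" using k(2) by simp
  then have "real (nat \<lfloor>X\<rfloor> + 1) \<le> real ((4 ^ (l + 1)) ^ (k + 1))" by (simp only: of_nat_le_iff)
  then have less: "X \<le> (4 ^ (l + 1)) ^ (k + 1)"
    using X by simp linarith
  have "X powr (1 - \<epsilon>) \<le> X powr (1 - 1 / (l + 1))"
    using X l(2) by (intro powr_mono) auto
  also have "\<dots> \<le> ((4 ^ (l + 1)) ^ (k + 1)) powr (1 - 1 / (l + 1))"
    using X less by (intro powr_mono2) (auto simp: field_simps)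
  also have "\<dots> = 4 powr (real ((l + 1) * (k + 1)) * (1 - 1 / (l + 1)))"
  proof -
    have "((4::real) ^ (l + 1)) ^ (k + 1) = 4 powr real ((l + 1) * (k + 1))"
      by (subst powr_realpow) (simp_all only: power_mult zero_less_numeral)
    then show ?thesis by (simp only: powr_powr)
  qed
  also have "real ((l + 1) * (k + 1)) * (1 - 1 / (l + 1)) = real (l * (k + 1))"
    by (simp add: field_simps)
  also have "4 powr \<dots> = (4::real) ^ l * 4 ^ (l * k)"
    by (subst powr_realpow) (simp_all add: power_add[symmetric])
  also have "(4::real) ^ (l * k) = real (((2 ^ l)\<^sup>2) ^ k)"
    by (simp add: h power_mult)
  also have "((2 ^ l)\<^sup>2) ^ k \<le> max_int_avoiding TYPE(3) X \<delta>"
  proof (rule max_int_avoiding_3_ge[OF _ \<delta>(1)])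
    have "(real (2 ^ l))\<^sup>2 = 4 ^ l"
      using h by (simp only: of_nat_power[symmetric]) simp
    then show "\<delta> \<le> 1 / (3 * (16 * (real (2 ^ l))\<^sup>2) * (16 * (real (2 ^ l))\<^sup>2))"
      using \<delta>(2) by (simp only:)
    show "real ((4 * (2 ^ l)\<^sup>2) ^ k) \<le> X"
      using le by (simp add: h)
  qed simp
  finally show ?thesis by simp
qed

lemma max_int_avoiding_4_ge:
  fixes X :: real
  assumes \<delta>: "0 < \<delta>" "\<delta> \<le> 1 / (3 * 1300 * 7500)" and X: "0 \<le> X"
  shows "nat \<lfloor>X\<rfloor> \<le> max_int_avoiding TYPE(4) X \<delta>"
proof -
  define n where "n = nat \<lfloor>X\<rfloor>"
  \<comment> \<open>Level \<open>n\<close> of the path is fine enough for all indices below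
    \<open>n\<close>, since the bounds at level \<open>n\<close> hold up to index distance
    \<open>25 ^ n\<close>.\<close>
  have "n < 25 ^ n"
    by (rule order.strict_trans2[OF less_exp]) (simp add: power_mono)
  \<comment> \<open>The path is translated so that the point of index 0 is the origin.\<close>
  define f :: "nat \<Rightarrow> lattice" where "f i = curve n (int i) - curve n 0" for i
  define p :: "nat \<Rightarrow> real ^ 4" where "p i = (\<chi> j. if j = 1 then real i
      else if j = 2 then fst (f i) / sqrt 7500
      else if j = 3 then fst (snd (f i)) / sqrt 7500
      else snd (snd (f i)) / sqrt 7500)" for i
  have norm: "(norm (p i - p j))\<^sup>2
      = (real_of_int (int i - int j))\<^sup>2 + norm_sq (curve n i - curve n j) / 7500" for i j
  proof -
    obtain x y z where fi: "f i = (x, y, z)" by (metis surj_pair)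
    obtain x' y' z' where fj: "f j = (x', y', z')" by (metis surj_pair)
    have "curve n i - curve n j = f i - f j"
      by (simp add: f_def)
    also have "\<dots> = (x - x', y - y', z - z')"
      by (simp add: fi fj)
    finally show ?thesis
      unfolding power2_norm_eq_inner
      by (simp add: inner_vec_def sum_4 p_def fi fj field_simps power2_eq_square)
  qed
  have "n \<le> max_int_avoiding TYPE(4) X \<delta>"
  proof (rule max_int_avoiding_ge_of_snowflake[OF _ _ \<delta> _ _ X _ norm])
    show "p 0 = 0"
      by (simp add: p_def f_def vec_eq_iff)
  next
    fix i assume "i < n"
    then show "real_of_int (\<bar>int i\<bar> + 1) \<le> X"
      unfolding n_def by linarith
  next
    fix i j assume ij: "i < n" "j < n" "i \<noteq> j"
    have "\<bar>int i - int j\<bar> \<le> int n" using ij by linarith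
    also have "\<dots> \<le> 25 ^ n" using \<open>n < 25 ^ n\<close> by (metis less_imp_le of_nat_le_iff of_nat_numeral of_nat_power)
    finally have "\<bar>int i - int j\<bar> \<le> 25 ^ n" .
    from curve_norm_sq_bounds[OF _ this] ij
    have *: "\<bar>int i - int j\<bar> \<le> 1300 * norm_sq (curve n i - curve n j)"
      "norm_sq (curve n i - curve n j) \<le> 7500 * \<bar>int i - int j\<bar>" by auto
    have "real_of_int \<bar>int i - int j\<bar> \<le> real_of_int (1300 * norm_sq (curve n i - curve n j))"
      using *(1) by (simp only: of_int_le_iff)
    moreover have "real_of_int (norm_sq (curve n i - curve n j)) \<le> real_of_int (7500 * \<bar>int i - int j\<bar>)"
      using *(2) by (simp only: of_int_le_iff)
    ultimately show "int i \<noteq> int j \<and> real_of_int \<bar>int i - int j\<bar> \<le> 1300 * real_of_int (norm_sq (curve n i - curve n j)) \<and>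
        real_of_int (norm_sq (curve n i - curve n j)) \<le> 7500 * real_of_int \<bar>int i - int j\<bar>"
      using ij(3) by simp
  qed auto
  then show ?thesis by (simp add: n_def)
qed

theorem theorem1p3:
  fixes \<epsilon> :: real
  assumes "0 < \<epsilon>" "\<epsilon> < 1"
  shows "\<exists>\<delta>\<^sub>0>0. \<forall>\<delta>::real. 0 < \<delta> \<and> \<delta> < 1/2 \<and> \<delta> \<le> \<delta>\<^sub>0 \<longrightarrow>
           (\<lambda>X. real (max_int_avoiding TYPE(3) X \<delta>)) \<in> \<Omega>[at_top](\<lambda>X. X powr (1 - \<epsilon>)) \<and>
           (\<lambda>X. real (max_int_avoiding TYPE(4) X \<delta>)) \<in> \<Omega>[at_top](\<lambda>X. X)"
proof -
  obtain l :: nat where l: "0 < l" "1 / (l + 1) \<le> \<epsilon>"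
  proof -
    define N where "N = nat \<lceil>1 / \<epsilon>\<rceil>"
    have "1 / \<epsilon> \<le> real N + 1"
      unfolding N_def by linarith
    then have "1 \<le> (real N + 1) * \<epsilon>"
      using assms(1) by (simp only: pos_divide_le_eq)
    then have "1 / (N + 1) \<le> \<epsilon>"
      by (simp add: divide_le_eq mult.commute add.commute)
    moreover have "0 < N"
      using assms(1) by (simp add: N_def)
    ultimately show ?thesis using that by blast
  qed
  define \<delta>\<^sub>0 :: real where
    "\<delta>\<^sub>0 = min (1 / (3 * (16 * 4 ^ l) * (16 * 4 ^ l))) (1 / (3 * 1300 * 7500))"
  have "(\<lambda>X. real (max_int_avoiding TYPE(3) X \<delta>)) \<in> \<Omega>[at_top](\<lambda>X. X powr (1 - \<epsilon>))"
    "(\<lambda>X. real (max_int_avoiding TYPE(4) X \<delta>)) \<in> \<Omega>[at_top](\<lambda>X. X)"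
    if \<delta>: "0 < \<delta>" "\<delta> \<le> \<delta>\<^sub>0" for \<delta>
  proof -
    have "1 / 4 ^ l * X powr (1 - \<epsilon>) \<le> real (max_int_avoiding TYPE(3) X \<delta>)" if "1 \<le> X" for X
      using max_int_avoiding_3_growth[OF l \<delta>(1) _ that] \<delta>(2)
      by (simp add: \<delta>\<^sub>0_def field_simps)
    then have "\<forall>\<^sub>F X in at_top. 1 / 4 ^ l * norm (X powr (1 - \<epsilon>)) \<le> norm (real (max_int_avoiding TYPE(3) X \<delta>))"
      by (intro eventually_at_top_linorderI[of 1]) simp
    then show "(\<lambda>X. real (max_int_avoiding TYPE(3) X \<delta>)) \<in> \<Omega>[at_top](\<lambda>X. X powr (1 - \<epsilon>))"
      by (rule landau_omega.bigI[rotated]) simp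
    \<comment> \<open>The factor \<open>1 / 2\<close> absorbs the floor: for
      \<open>1 \<le> X\<close> its value is at least 1, so \<open>X\<close> is at most twice the
      floor.\<close>
    have "1 / 2 * X \<le> real (max_int_avoiding TYPE(4) X \<delta>)" if "1 \<le> X" for X
    proof -
      have "real (nat \<lfloor>X\<rfloor>) \<le> real (max_int_avoiding TYPE(4) X \<delta>)"
        using max_int_avoiding_4_ge[of \<delta> X] \<delta> that by (simp add: \<delta>\<^sub>0_def)
      moreover have "X \<le> real (nat \<lfloor>X\<rfloor>) + 1"
        by linarith
      moreover have "1 \<le> nat \<lfloor>X\<rfloor>"
        using that by linarith
      ultimately show ?thesis by simp
    qed
    then have "\<forall>\<^sub>F X in at_top. 1 / 2 * norm X \<le> norm (real (max_int_avoiding TYPE(4) X \<delta>))"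
      by (intro eventually_at_top_linorderI[of 1]) simp
    then show "(\<lambda>X. real (max_int_avoiding TYPE(4) X \<delta>)) \<in> \<Omega>[at_top](\<lambda>X. X)"
      by (rule landau_omega.bigI[rotated]) simp
  qed
  moreover have "0 < \<delta>\<^sub>0" by (simp add: \<delta>\<^sub>0_def)
  ultimately show ?thesis by blast
qed

end
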